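(* Let $T$ be a tree, let $u,v$ be distinct nonadjacent vertices of $T$, and let $U=T+uv$. Let $C=(c_0,c_1,\dots,c_{\ell-1})$ be the unique cycle of $U$, listed cyclically, with $c_0=u$ and $c_{\ell-1}=v$. Deleting the edges of $C$ from $U$ leaves trees $R_0,\dots,R_{\ell-1}$, where $R_i$ is the component containing $c_i$, rooted at $c_i$. For each $i$ define $$A_i(x)=I(R_i-c_i;x),\qquad B_i(x)=x\,I(R_i-N_{R_i}[c_i];x).$$ Set $f_0^{(0)}=A_0$, $g_0^{(0)}=0$, $f_0^{(1)}=0$, $g_0^{(1)}=B_0$, and for $1\le i\le \ell-1$ and $\varepsilon\in\{0,1\}$ set $$f_i^{(\varepsilon)}=\bigl(f_{i-1}^{(\varepsilon)}+g_{i-1}^{(\varepsilon)}\bigr)A_i,\qquad g_i^{(\varepsilon)}=f_{i-1}^{(\varepsilon)}B_i .$$ Then $$I(U;x)=\bigl(f_{\ell-1}^{(0)}+g_{\ell-1}^{(0)}\bigr)+f_{\ell-1}^{(1)}.$$ If moreover $A_i=A$ and $B_i=B$ for every $i$, then $$I(U;x)=A(x)^{\ell}\,I\!\left(C_\ell;\frac{B(x)}{A(x)}\right),$$ where $C_\ell$ is the cycle graph on $\ell$ vertices.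
   Context: Graphs are finite and simple. $I(G;x)=\sum_{j\ge 0}s_j(G)x^j$ is the independence polynomial, where $s_j(G)$ is the number of independent sets of size $j$ in $G$ (so $I$ of the empty graph is $1$). $N_R[c]$ is the closed neighborhood of $c$ in $R$; $R-S$ denotes deletion of the vertices in $S$. $T+uv$ is $T$ with the edge $uv$ added, which has exactly one cycle. *)

theory Defs
  imports
    "Graph_Theory.Digraph_Component"
    "HOL-Computational_Algebra.Polynomial_Factorial"
begin

text \<open>
  A finite simple graph is a \<^const>\<open>pair_graph\<close>: a finite vertex set with a symmetric, irreflexive
  set of arcs, the edge \<open>uv\<close> being the pair of arcs \<open>(u, v)\<close>, \<open>(v, u)\<close>.

  \<^const>\<open>pre_digraph.cycle\<close> is the directed notion, for which \<open>u, v, u\<close> is a cycle whenever \<open>uv\<close> is an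
  edge; hence no symmetric digraph with an edge satisfies \<^const>\<open>tree\<close>. In a simple graph the cycles
  in the undirected sense are exactly those of length at least 3.
\<close>

definition graph_cycle :: "('a, 'b) pre_digraph \<Rightarrow> 'b list \<Rightarrow> bool" where
  "graph_cycle G p \<longleftrightarrow> pre_digraph.cycle G p \<and> 3 \<le> length p"

definition graph_tree :: "'a pair_pre_digraph \<Rightarrow> bool" where
  "graph_tree T \<longleftrightarrow>
     pair_graph T \<and> connected (with_proj T) \<and> \<not> (\<exists>p. graph_cycle (with_proj T) p)"

definition add_edge :: "'a pair_pre_digraph \<Rightarrow> 'a \<Rightarrow> 'a \<Rightarrow> 'a pair_pre_digraph" where
  "add_edge G u v = \<lparr> pverts = pverts G, parcs = parcs G \<union> {(u, v), (v, u)} \<rparr>"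

definition del_edges :: "'a pair_pre_digraph \<Rightarrow> ('a \<times> 'a) set \<Rightarrow> 'a pair_pre_digraph" where
  "del_edges G F = \<lparr> pverts = pverts G, parcs = parcs G - (F \<union> F\<inverse>) \<rparr>"

definition del_verts :: "('a, 'b) pre_digraph \<Rightarrow> 'a set \<Rightarrow> ('a, 'b) pre_digraph" where
  "del_verts G S = G \<restriction> (verts G - S)"

text \<open>For symmetric digraphs strong components are the connected components.\<close>

definition component_of :: "'a pair_pre_digraph \<Rightarrow> 'a \<Rightarrow> ('a, 'a \<times> 'a) pre_digraph" where
  "component_of G c = with_proj G \<restriction> pre_digraph.scc_of (with_proj G) c"

definition closed_nbhd :: "('a, 'b) pre_digraph \<Rightarrow> 'a \<Rightarrow> 'a set" where
  "closed_nbhd G c = insert c {w. c \<rightarrow>\<^bsub>G\<^esub> w}"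

definition cycle_graph :: "nat \<Rightarrow> nat pair_pre_digraph" where
  "cycle_graph n =
     \<lparr> pverts = {..<n},
       parcs = {(i, j). i < n \<and> j < n \<and> (j = (i + 1) mod n \<or> i = (j + 1) mod n)} \<rparr>"

definition indep_set :: "('a, 'b) pre_digraph \<Rightarrow> 'a set \<Rightarrow> bool" where
  "indep_set G S \<longleftrightarrow> S \<subseteq> verts G \<and> (\<forall>x\<in>S. \<forall>y\<in>S. \<not> x \<rightarrow>\<^bsub>G\<^esub> y)"

text \<open>For finite \<open>G\<close> there are no independent sets of size larger than \<open>card (verts G)\<close>.\<close>

definition indep_poly :: "('a, 'b) pre_digraph \<Rightarrow> int poly" where
  "indep_poly G =
     (\<Sum>j\<le>card (verts G). monom (int (card {S. indep_set G S \<and> card S = j})) j)"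

end

theory Submission
  imports Defs
begin

text \<open>
  Away from the cycle, \<open>U\<close> splits into the vertex-disjoint rooted trees \<open>R\<^sub>i\<close>, so an independent set
  of \<open>U\<close> is a choice of an independent set in every \<open>R\<^sub>i\<close> such that the indices whose roots are
  chosen form an independent set \<open>J\<close> of the cycle graph. Hence
  \<open>I(U) = \<Sum>\<^sub>J \<Prod>\<^sub>i (if i \<in> J then B\<^sub>i else A\<^sub>i)\<close>. The recursion for \<open>f\<close>, \<open>g\<close> evaluates the analogous sums
  over the path \<open>0, \<dots>, i\<close>, split according to whether the two ends belong to \<open>J\<close>; closing the path
  to a cycle only forbids that both ends belong to \<open>J\<close>. For constant \<open>A\<close>, \<open>B\<close> the product is
  \<open>A\<^sup>l (B/A)\<^bsup>|J|\<^esup>\<close>.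
\<close>

section \<open>Independence polynomials as generating functions\<close>

lemma finite_indep_sets: "finite (verts G) \<Longrightarrow> finite {S. indep_set G S}"
  by (rule finite_subset[of _ "Pow (verts G)"]) (auto simp: indep_set_def)

text \<open>Grouping independent sets by cardinality recovers the coefficients. The later bijections
  act on this ungrouped form.\<close>

lemma indep_poly_eq_sum:
  assumes fin: "finite (verts G)"
  shows "indep_poly G = (\<Sum>S | indep_set G S. monom 1 (card S))"
proof -
  have "(\<Sum>S | indep_set G S. monom (1::int) (card S)) =
      (\<Sum>j\<le>card (verts G). \<Sum>S\<in>{S \<in> {S. indep_set G S}. card S = j}. monom 1 (card S))"
    by (rule sum.group[symmetric])
      (use fin in \<open>auto simp: finite_indep_sets indep_set_def card_mono\<close>)
  also have "\<dots> = indep_poly G"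
    unfolding indep_poly_def
    by (rule sum.cong) (auto simp: of_nat_monom mult_monom)
  finally show ?thesis ..
qed

text \<open>The value at 1 counts the independent sets, and the empty set is one of them. This later
  makes division by \<open>A\<close> legitimate.\<close>

lemma indep_poly_nonzero:
  assumes fin: "finite (verts G)"
  shows "indep_poly G \<noteq> 0"
proof -
  have "poly (indep_poly G) 1 = int (card {S. indep_set G S})"
    by (simp add: indep_poly_eq_sum fin poly_sum poly_monom)
  moreover have "{} \<in> {S. indep_set G S}"
    by (simp add: indep_set_def)
  then have "card {S. indep_set G S} > 0"
    using finite_indep_sets[OF fin] by (auto simp: card_gt_0_iff)
  ultimately show ?thesis by auto
qed

lemma arcs_ends_del_verts:
  "x \<rightarrow>\<^bsub>del_verts G S\<^esub> y \<longleftrightarrow> x \<rightarrow>\<^bsub>G\<^esub> y \<and> x \<in> verts G - S \<and> y \<in> verts G - S"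
  by (auto simp: del_verts_def induce_subgraph_def arcs_ends_conv)

lemma verts_del_verts: "verts (del_verts G S) = verts G - S"
  by (simp add: del_verts_def induce_subgraph_def)

lemma indep_set_del_verts: "indep_set (del_verts G S) X \<longleftrightarrow> indep_set G X \<and> X \<inter> S = {}"
  by (auto simp: indep_set_def arcs_ends_del_verts verts_del_verts)

lemma indep_poly_del_vert:
  assumes fin: "finite (verts G)"
  shows "indep_poly (del_verts G {r}) = (\<Sum>S | indep_set G S \<and> r \<notin> S. monom 1 (card S))"
  using fin by (simp add: indep_poly_eq_sum verts_del_verts indep_set_del_verts)

text \<open>Removing \<open>r\<close> from an independent set that contains it leaves one that
  misses \<open>closed_nbhd G r\<close>, and this is reversible. The factor \<open>[:0, 1:]\<close>
  accounts for \<open>r\<close> itself.\<close>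

lemma indep_poly_del_closed_nbhd:
  assumes fin: "finite (verts G)" and r: "r \<in> verts G"
    and sym: "symmetric G" and loop: "\<not> r \<rightarrow>\<^bsub>G\<^esub> r"
  shows "[:0, 1:] * indep_poly (del_verts G (closed_nbhd G r)) =
    (\<Sum>S | indep_set G S \<and> r \<in> S. monom 1 (card S))"
proof -
  let ?N = "closed_nbhd G r"
  have sym': "x \<rightarrow>\<^bsub>G\<^esub> y \<Longrightarrow> y \<rightarrow>\<^bsub>G\<^esub> x" for x y
    using sym by (rule arcs_ends_symmetric)
  have "[:0, 1:] * indep_poly (del_verts G ?N) =
      (\<Sum>S | indep_set G S \<and> S \<inter> ?N = {}. monom 1 (Suc (card S)))"
    using fin by (simp add: indep_poly_eq_sum verts_del_verts indep_set_del_verts sum_distrib_left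
        monom_Suc)
  also have "\<dots> = (\<Sum>S | indep_set G S \<and> r \<in> S. monom 1 (card S))"
  proof (rule sum.reindex_bij_witness[where i = "\<lambda>S. S - {r}" and j = "insert r"])
    fix S assume "S \<in> {S. indep_set G S \<and> S \<inter> ?N = {}}"
    then have S: "indep_set G S" "S \<inter> ?N = {}" by auto
    then have "finite S" using fin by (auto simp: indep_set_def intro: finite_subset)
    moreover have "r \<notin> S" using S by (auto simp: closed_nbhd_def)
    ultimately show "monom 1 (card (insert r S)) = monom 1 (Suc (card S))" by simp
    show "insert r S - {r} = S" using \<open>r \<notin> S\<close> by simp
    show "insert r S \<in> {S. indep_set G S \<and> r \<in> S}"
      using S r loop sym' by (auto simp: indep_set_def closed_nbhd_def)
  next
    fix S assume "S \<in> {S. indep_set G S \<and> r \<in> S}"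
    then show "insert r (S - {r}) = S" "S - {r} \<in> {S. indep_set G S \<and> S \<inter> ?N = {}}"
      by (auto simp: indep_set_def closed_nbhd_def)
  qed
  finally show ?thesis .
qed

section \<open>Rooted graphs glued along a graph on their roots\<close>

text \<open>An independent set of \<open>G\<close> is determined by its traces on the disjoint
  \<open>R i\<close>. The only constraint between different traces concerns the roots, and it says
  that the set \<open>J\<close> of indices with chosen root is independent in
  \<open>H\<close>.\<close>

lemma indep_poly_rooted_product:
  fixes R :: "'i \<Rightarrow> ('a, 'b) pre_digraph" and G :: "('a, 'c) pre_digraph"
    and H :: "('i, 'd) pre_digraph"
  assumes finH: "finite (verts H)"
    and finR: "\<And>i. i \<in> verts H \<Longrightarrow> finite (verts (R i))"
    and verts_G: "verts G = (\<Union>i\<in>verts H. verts (R i))"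
    and disj: "\<And>i j. i \<in> verts H \<Longrightarrow> j \<in> verts H \<Longrightarrow> i \<noteq> j \<Longrightarrow> verts (R i) \<inter> verts (R j) = {}"
    and wfR: "\<And>i. i \<in> verts H \<Longrightarrow> wf_digraph (R i)" and wfH: "wf_digraph H"
    and root: "\<And>i. i \<in> verts H \<Longrightarrow> c i \<in> verts (R i)"
    and arcs_G: "\<And>x y. x \<rightarrow>\<^bsub>G\<^esub> y \<longleftrightarrow>
      (\<exists>i\<in>verts H. x \<rightarrow>\<^bsub>R i\<^esub> y) \<or> (\<exists>i j. i \<rightarrow>\<^bsub>H\<^esub> j \<and> x = c i \<and> y = c j)"
  shows "indep_poly G =
    (\<Sum>J | indep_set H J. \<Prod>i\<in>verts H.
       \<Sum>S | indep_set (R i) S \<and> (c i \<in> S \<longleftrightarrow> i \<in> J). monom 1 (card S))"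
proof -
  let ?I = "verts H"
  let ?F = "\<lambda>J i. {S. indep_set (R i) S \<and> (c i \<in> S \<longleftrightarrow> i \<in> J)}"
  have finF: "finite (?F J i)" if "i \<in> ?I" for J i
    by (rule finite_subset[OF _ finite_indep_sets[OF finR[OF that]]]) auto
  have H_in: "i \<in> ?I" "j \<in> ?I" if "i \<rightarrow>\<^bsub>H\<^esub> j" for i j
    using that wf_digraph.adj_in_verts[OF wfH] by auto
  have R_in: "x \<in> verts (R i)" "y \<in> verts (R i)" if "x \<rightarrow>\<^bsub>R i\<^esub> y" "i \<in> ?I" for i x y
    using that wf_digraph.adj_in_verts[OF wfR] by auto
  have root_eq: "i = j" if "i \<in> ?I" "j \<in> ?I" "c i \<in> verts (R j)" for i j
    using that disj[of i j] root[of i] by auto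
  have finG: "finite (verts G)" using finH finR verts_G by auto
  \<comment> \<open>The product of sums expands into a sum over choice functions \<open>h\<close>,
    so what remains is a bijection between pairs \<open>(J, h)\<close> and independent sets of
    \<open>G\<close>.\<close>
  have "(\<Sum>J | indep_set H J. \<Prod>i\<in>?I. \<Sum>S\<in>?F J i. monom (1::int) (card S)) =
      (\<Sum>J | indep_set H J. \<Sum>h\<in>PiE ?I (?F J). \<Prod>i\<in>?I. monom 1 (card (h i)))"
    by (intro sum.cong refl prod_sum_PiE finH finF)
  also have "\<dots> = (\<Sum>(J, h)\<in>Sigma {J. indep_set H J} (\<lambda>J. PiE ?I (?F J)).
      \<Prod>i\<in>?I. monom 1 (card (h i)))"
    by (intro sum.Sigma) (auto intro!: finite_indep_sets finite_PiE finH finF)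
  also have "\<dots> = (\<Sum>S | indep_set G S. monom 1 (card S))"
  proof (rule sum.reindex_bij_witness[where
        i = "\<lambda>S. ({i \<in> ?I. c i \<in> S}, \<lambda>i\<in>?I. S \<inter> verts (R i))" and
        j = "\<lambda>(J, h). \<Union>i\<in>?I. h i"])
    fix Jh assume Jh_in: "Jh \<in> Sigma {J. indep_set H J} (\<lambda>J. PiE ?I (?F J))"
    obtain J h where Jh: "Jh = (J, h)" by fastforce
    with Jh_in have J: "indep_set H J" and h: "h \<in> PiE ?I (?F J)" by auto
    have hR: "indep_set (R i) (h i)" "h i \<subseteq> verts (R i)" "c i \<in> h i \<longleftrightarrow> i \<in> J" if "i \<in> ?I" for i
      using h that by (auto simp: PiE_iff indep_set_def)
    have inter: "(\<Union>j\<in>?I. h j) \<inter> verts (R i) = h i" if "i \<in> ?I" for i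
      using that hR(2) disj by blast
    have root_iff: "c i \<in> (\<Union>j\<in>?I. h j) \<longleftrightarrow> i \<in> J" if "i \<in> ?I" for i
      using that inter[OF that] hR(3)[OF that] root[OF that] by blast
    \<comment> \<open>Recovering \<open>h\<close> as a function uses that it is
      \<open>undefined\<close> outside the index set, which is why the inverse map
      restricts.\<close>
    show "(\<lambda>S. ({i \<in> ?I. c i \<in> S}, \<lambda>i\<in>?I. S \<inter> verts (R i))) ((\<lambda>(J, h). \<Union>i\<in>?I. h i) Jh) = Jh"
      using J h root_iff inter unfolding Jh
      by (auto simp: indep_set_def PiE_iff extensional_def restrict_def fun_eq_iff)
    have "\<not> x \<rightarrow>\<^bsub>G\<^esub> y" if xy: "x \<in> (\<Union>i\<in>?I. h i)" "y \<in> (\<Union>i\<in>?I. h i)" for x y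
    proof
      assume "x \<rightarrow>\<^bsub>G\<^esub> y"
      then consider i where "i \<in> ?I" "x \<rightarrow>\<^bsub>R i\<^esub> y"
        | i j where "i \<rightarrow>\<^bsub>H\<^esub> j" "x = c i" "y = c j"
        using arcs_G by blast
      then show False
      proof cases
        \<comment> \<open>An arc inside some \<open>R i\<close> contradicts independence of
          \<open>h i\<close>; an arc between roots, in the other case, contradicts independence of
          \<open>J\<close> in \<open>H\<close>.\<close>
        case 1
        then have "x \<in> h i" "y \<in> h i" using xy inter R_in by blast+
        with 1 hR(1)[of i] show False by (auto simp: indep_set_def)
      next
        case 2
        then have "i \<in> J" "j \<in> J" using xy root_iff H_in by auto
        with 2 J show False by (auto simp: indep_set_def)
      qed
    qed
    moreover have "(\<Union>i\<in>?I. h i) \<subseteq> verts G"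
      using hR(2) verts_G by blast
    ultimately show "(\<lambda>(J, h). \<Union>i\<in>?I. h i) Jh \<in> {S. indep_set G S}"
      by (auto simp: Jh indep_set_def)
    have "card (\<Union>i\<in>?I. h i) = (\<Sum>i\<in>?I. card (h i))"
    proof (rule card_UN_disjoint[OF finH])
      show "\<forall>i\<in>?I. finite (h i)" using hR(2) finR finite_subset by blast
      show "\<forall>i\<in>?I. \<forall>j\<in>?I. i \<noteq> j \<longrightarrow> h i \<inter> h j = {}" using hR(2) disj by blast
    qed
    moreover have "(\<Prod>i\<in>I. monom (1::int) (card (h i))) = monom 1 (\<Sum>i\<in>I. card (h i))"
      if "finite I" for I
      using that by induction (auto simp: mult_monom)
    ultimately show "monom 1 (card ((\<lambda>(J, h). \<Union>i\<in>?I. h i) Jh)) =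
        (\<lambda>(J, h). \<Prod>i\<in>?I. monom (1::int) (card (h i))) Jh"
      using finH by (simp add: Jh)
  next
    fix S assume "S \<in> {S. indep_set G S}"
    then have S: "S \<subseteq> verts G" "\<And>x y. x \<in> S \<Longrightarrow> y \<in> S \<Longrightarrow> \<not> x \<rightarrow>\<^bsub>G\<^esub> y"
      by (auto simp: indep_set_def)
    show "(\<lambda>(J, h). \<Union>i\<in>?I. h i) ({i \<in> ?I. c i \<in> S}, \<lambda>i\<in>?I. S \<inter> verts (R i)) = S"
      using S(1) verts_G by auto
    have "indep_set H {i \<in> ?I. c i \<in> S}"
      unfolding indep_set_def using S(2) arcs_G by blast
    moreover have "indep_set (R i) (S \<inter> verts (R i))" if "i \<in> ?I" for i
      unfolding indep_set_def using that S(2) arcs_G by blast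
    ultimately show "({i \<in> ?I. c i \<in> S}, \<lambda>i\<in>?I. S \<inter> verts (R i))
        \<in> Sigma {J. indep_set H J} (\<lambda>J. PiE ?I (?F J))"
      using root by auto
  qed
  also have "\<dots> = indep_poly G" by (simp add: indep_poly_eq_sum finG)
  finally show ?thesis ..
qed

section \<open>Independent sets of paths and cycles, and the transfer recursion\<close>

text \<open>The independent sets of the path on the \<open>n + 1\<close> vertices
  \<open>0, ..., n\<close>. The parameter is the last vertex, in step with the index of
  \<open>f\<close> and \<open>g\<close>.\<close>

definition path_indep_sets :: "nat \<Rightarrow> nat set set" where
  "path_indep_sets n = {J. J \<subseteq> {..n} \<and> (\<forall>i\<in>J. Suc i \<notin> J)}"

lemma finite_path_indep_sets: "finite {J \<in> path_indep_sets n. P J}"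
  by (rule finite_subset[of _ "Pow {..n}"]) (auto simp: path_indep_sets_def)

lemma pverts_cycle_graph: "pverts (cycle_graph n) = {..<n}"
  by (simp add: cycle_graph_def)

lemma dominates_cycle_graph:
  "i \<rightarrow>\<^bsub>with_proj (cycle_graph n)\<^esub> j \<longleftrightarrow>
     i < n \<and> j < n \<and> (j = (i + 1) mod n \<or> i = (j + 1) mod n)"
  by (simp add: cycle_graph_def)

text \<open>The cyclic successor is \<open>Suc i\<close> except at \<open>i = n\<close>, where it
  wraps to \<open>0\<close>; that one edge forbids choosing both ends. For \<open>n = 0\<close> it
  is a loop, and the equivalence still holds.\<close>

lemma indep_set_cycle_graph:
  "indep_set (with_proj (cycle_graph (Suc n))) J \<longleftrightarrow>
     J \<in> path_indep_sets n \<and> \<not> (0 \<in> J \<and> n \<in> J)"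
proof -
  have "(\<forall>x\<in>J. \<forall>y\<in>J. \<not> x \<rightarrow>\<^bsub>with_proj (cycle_graph (Suc n))\<^esub> y) \<longleftrightarrow>
      (\<forall>i\<in>J. Suc i \<notin> J) \<and> \<not> (0 \<in> J \<and> n \<in> J)" if J: "J \<subseteq> {..n}"
  proof -
    have "(\<forall>x\<in>J. \<forall>y\<in>J. \<not> x \<rightarrow>\<^bsub>with_proj (cycle_graph (Suc n))\<^esub> y) \<longleftrightarrow>
        (\<forall>i\<in>J. (i + 1) mod Suc n \<notin> J)"
      unfolding dominates_cycle_graph using J by (auto simp: less_Suc_eq_le)
    also have "\<dots> \<longleftrightarrow> (\<forall>i\<in>J. (if i = n then 0 else Suc i) \<notin> J)"
      using J by (intro ball_cong refl) (auto simp: subset_iff)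
    also have "\<dots> \<longleftrightarrow> (\<forall>i\<in>J. Suc i \<notin> J) \<and> \<not> (0 \<in> J \<and> n \<in> J)"
      using J by (auto simp: subset_iff)
    finally show ?thesis .
  qed
  then show ?thesis
    unfolding indep_set_def path_indep_sets_def with_proj_simps(1) pverts_cycle_graph
      lessThan_Suc_atMost by auto
qed

text \<open>The Boolean \<open>b\<close> plays the role of \<epsilon> and fixes whether vertex
  \<open>0\<close> is chosen; \<open>f\<close> and \<open>g\<close> separate the sets that omit the
  last vertex from those that contain it. A new vertex may always be omitted, but may be chosen only
  if its predecessor is not.\<close>

lemma sum_path_indep_sets_transfer:
  fixes A B f g :: "nat \<Rightarrow> 'r :: comm_semiring_1"
  defines "w \<equiv> \<lambda>n J. \<Prod>i\<le>n. if i \<in> J then B i else A i"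
  assumes f_0: "f 0 = (if b then 0 else A 0)" and g_0: "g 0 = (if b then B 0 else 0)"
    and f_Suc: "\<And>i. i < n \<Longrightarrow> f (Suc i) = (f i + g i) * A (Suc i)"
    and g_Suc: "\<And>i. i < n \<Longrightarrow> g (Suc i) = f i * B (Suc i)"
  shows "f n = (\<Sum>J | J \<in> path_indep_sets n \<and> n \<notin> J \<and> (0 \<in> J \<longleftrightarrow> b). w n J)"
    and "g n = (\<Sum>J | J \<in> path_indep_sets n \<and> n \<in> J \<and> (0 \<in> J \<longleftrightarrow> b). w n J)"
proof -
  have w_Suc: "w (Suc m) J = w m J * (if Suc m \<in> J then B (Suc m) else A (Suc m))" for m J
    by (simp add: w_def)
  let ?F = "\<lambda>m. {J. J \<in> path_indep_sets m \<and> m \<notin> J \<and> (0 \<in> J \<longleftrightarrow> b)}"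
  let ?G = "\<lambda>m. {J. J \<in> path_indep_sets m \<and> m \<in> J \<and> (0 \<in> J \<longleftrightarrow> b)}"
  have "m \<le> n \<Longrightarrow> f m = sum (w m) (?F m) \<and> g m = sum (w m) (?G m)" for m
  proof (induction m)
    case 0
    have "?F 0 = (if b then {} else {{}})" "?G 0 = (if b then {{0}} else {})"
      by (auto simp: path_indep_sets_def)
    then show ?case by (simp add: f_0 g_0 w_def)
  next
    case (Suc m)
    have F_Suc: "?F (Suc m) = ?F m \<union> ?G m"
      by (auto simp: path_indep_sets_def le_Suc_eq)
    have "f (Suc m) = (sum (w m) (?F m) + sum (w m) (?G m)) * A (Suc m)"
      using Suc f_Suc by simp
    also have "\<dots> = sum (w m) (?F m \<union> ?G m) * A (Suc m)"
      by (subst sum.union_disjoint) (auto intro: finite_path_indep_sets)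
    also have "\<dots> = sum (w (Suc m)) (?F (Suc m))"
      unfolding F_Suc sum_distrib_right
      by (rule sum.cong) (auto simp: w_Suc path_indep_sets_def)
    finally have f: "f (Suc m) = sum (w (Suc m)) (?F (Suc m))" .
    \<comment> \<open>Deleting \<open>Suc m\<close> leaves a set that omits \<open>m\<close>, and
      does not affect the weights of the vertices up to \<open>m\<close>.\<close>
    have "sum (w (Suc m)) (?G (Suc m)) = (\<Sum>J\<in>?F m. w m J * B (Suc m))"
    proof (rule sum.reindex_bij_witness[where i = "insert (Suc m)" and j = "\<lambda>J. J - {Suc m}"])
      fix J assume J: "J \<in> ?G (Suc m)"
      then show "insert (Suc m) (J - {Suc m}) = J" "J - {Suc m} \<in> ?F m"
        by (auto simp: path_indep_sets_def le_Suc_eq)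
      have "w m (J - {Suc m}) = w m J" by (auto simp: w_def intro!: prod.cong)
      then show "w m (J - {Suc m}) * B (Suc m) = w (Suc m) J" using J by (simp add: w_Suc)
    next
      fix J assume J: "J \<in> ?F m"
      then show "insert (Suc m) J - {Suc m} = J" "insert (Suc m) J \<in> ?G (Suc m)"
        by (auto simp: path_indep_sets_def le_Suc_eq subset_iff)
    qed
    then have "g (Suc m) = sum (w (Suc m)) (?G (Suc m))"
      using Suc g_Suc by (simp add: sum_distrib_right)
    with f show ?case ..
  qed
  then show "f n = sum (w n) (?F n)" "g n = sum (w n) (?G n)" by auto
qed

text \<open>Of the four classes given by membership of the two ends, closing the path removes the
  one containing both. The literal \<open>False\<close> and \<open>True\<close> match the transfer
  lemma at the two values of \<open>b\<close>.\<close>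

lemma sum_indep_sets_cycle_graph:
  "(\<Sum>J | indep_set (with_proj (cycle_graph (Suc n))) J. w J) =
     (\<Sum>J | J \<in> path_indep_sets n \<and> n \<notin> J \<and> (0 \<in> J \<longleftrightarrow> False). w J) +
     (\<Sum>J | J \<in> path_indep_sets n \<and> n \<in> J \<and> (0 \<in> J \<longleftrightarrow> False). w J) +
     (\<Sum>J | J \<in> path_indep_sets n \<and> n \<notin> J \<and> (0 \<in> J \<longleftrightarrow> True). w J)"
  (is "_ = sum w ?S1 + sum w ?S2 + sum w ?S3")
proof -
  have "{J. indep_set (with_proj (cycle_graph (Suc n))) J} = ?S1 \<union> ?S2 \<union> ?S3"
    by (auto simp: indep_set_cycle_graph)
  moreover have "sum w (?S1 \<union> ?S2 \<union> ?S3) = sum w (?S1 \<union> ?S2) + sum w ?S3"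
    by (rule sum.union_disjoint) (auto intro: finite_path_indep_sets)
  moreover have "sum w (?S1 \<union> ?S2) = sum w ?S1 + sum w ?S2"
    by (rule sum.union_disjoint) (auto intro: finite_path_indep_sets)
  ultimately show ?thesis by simp
qed

section \<open>Evaluation at a quotient\<close>

text \<open>Allows the argument to be taken from any commutative ring, in particular the fraction
  \<open>B / A\<close> of integer polynomials.\<close>

lemma poly_of_int_indep_poly:
  fixes x :: "'r :: comm_ring_1"
  assumes "finite (verts G)"
  shows "poly (map_poly of_int (indep_poly G)) x = (\<Sum>S | indep_set G S. x ^ card S)"
proof -
  have add: "map_poly of_int (p + q) = map_poly (of_int :: int \<Rightarrow> 'r) p + map_poly of_int q" for p q
    by (rule poly_eqI) (simp add: coeff_map_poly)
  have "poly (map_poly of_int (\<Sum>S\<in>X. monom 1 (card S))) x = (\<Sum>S\<in>X. x ^ card S)"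
    if "finite X" for X :: "'a set set"
    using that by induction (simp_all add: add map_poly_monom poly_monom)
  then show ?thesis
    by (simp add: indep_poly_eq_sum assms finite_indep_sets)
qed

lemma prod_if_mem_eq_power:
  fixes a b :: "'r :: field"
  assumes "finite I" "J \<subseteq> I" "a \<noteq> 0"
  shows "(\<Prod>i\<in>I. if i \<in> J then b else a) = a ^ card I * (b / a) ^ card J"
proof -
  have "(\<Prod>i\<in>I. if i \<in> J then b else a) = (\<Prod>i\<in>I. a * (if i \<in> J then b / a else 1))"
    using assms by (intro prod.cong) auto
  also have "\<dots> = a ^ card I * (\<Prod>i\<in>I \<inter> J. b / a)"
    using assms by (simp add: prod.distrib flip: prod.inter_restrict)
  also have "I \<inter> J = J" using assms by auto
  finally show ?thesis by simp
qed

section \<open>Trees, cycles, and the decomposition of a unicyclic graph\<close>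

lemma pair_graph_del_edges:
  assumes "pair_graph G"
  shows "pair_graph (del_edges G F)"
proof -
  interpret pair_graph G by fact
  show ?thesis
    by unfold_locales
      (use wellformed' no_loops' arcs_symmetric in
        \<open>auto simp: del_edges_def symmetric_def sym_def intro: finite_subset[OF _ pair_finite_arcs]\<close>)
qed

lemma pair_graph_add_edge:
  assumes "pair_graph G" "u \<in> pverts G" "v \<in> pverts G" "u \<noteq> v"
  shows "pair_graph (add_edge G u v)"
proof -
  interpret pair_graph G by fact
  show ?thesis
    by unfold_locales
      (use assms(2-) wellformed' no_loops' arcs_symmetric in
        \<open>auto simp: add_edge_def symmetric_def sym_def\<close>)
qed

text \<open>A walk joining the ends of an edge of a tree without using it would close up to a cycle.\<close>
lemma graph_tree_bridge:
  assumes tree: "graph_tree T" and ab: "(a, b) \<in> parcs T"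
  shows "(b, a) \<notin> (parcs T - {(a, b), (b, a)})\<^sup>*"
proof
  assume ba: "(b, a) \<in> (parcs T - {(a, b), (b, a)})\<^sup>*"
  let ?D = "del_edges T {(a, b)}"
  have T: "pair_graph T" and acyclic: "\<And>p. \<not> graph_cycle (with_proj T) p"
    using tree by (auto simp: graph_tree_def)
  interpret T: pair_graph T by fact
  interpret D: pair_graph ?D by (rule pair_graph_del_edges) fact
  have D: "pverts ?D = pverts T" "parcs ?D = parcs T - {(a, b), (b, a)}"
    by (auto simp: del_edges_def)
  have "b \<in> pverts T" "a \<noteq> b" using ab T.wellformed' T.no_loops' by auto
  then have "b \<rightarrow>\<^sup>*\<^bsub>with_proj ?D\<^esub> a"
    using ba D D.reachable_conv'[of b a] by simp
  then obtain p where p: "D.apath b p a" by (auto simp: D.reachable_apath)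
  then have arcs_p: "set p \<subseteq> parcs T - {(a, b), (b, a)}" and cas_p: "pcas b p a"
    and distinct_p: "distinct (pawalk_verts b p)"
    by (auto simp: D.apath_def D.awalk_def D)
  \<comment> \<open>The closed walk must have length at least 3 to count as a
    \<open>graph_cycle\<close>: the ends differ, and a path of one arc would be the deleted
    \<open>(b, a)\<close>.\<close>
  have "p \<noteq> []" using cas_p \<open>a \<noteq> b\<close> by auto
  moreover have "p \<noteq> [e]" for e using cas_p arcs_p by (cases e) auto
  ultimately have "length p \<ge> 2" by (cases p) (auto simp: neq_Nil_conv Suc_le_eq)
  moreover have "T.cycle ((a, b) # p)"
    unfolding T.cycle_def T.awalk_def
    using arcs_p cas_p distinct_p ab T.wellformed' by (intro exI[of _ a]) auto
  ultimately show False using acyclic[of "(a, b) # p"] by (simp add: graph_cycle_def)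
qed

text \<open>\<open>connected\<close> speaks of the symmetric closure, which has the same
  reachability as the already symmetric \<open>T\<close>.\<close>

lemma graph_tree_connected:
  assumes "graph_tree T" "x \<in> pverts T" "y \<in> pverts T"
  shows "(x, y) \<in> (parcs T)\<^sup>*"
proof -
  interpret pair_graph T using assms(1) by (simp add: graph_tree_def)
  have "strongly_connected (with_proj (mk_symmetric (with_proj T)))"
    using assms(1) by (simp add: graph_tree_def connected_def)
  then have "x \<rightarrow>\<^sup>*\<^bsub>with_proj (mk_symmetric (with_proj T))\<^esub> y"
    using assms(2,3) by (auto simp: strongly_connected_def mk_symmetric_def)
  then have "x \<rightarrow>\<^sup>*\<^bsub>with_proj T\<^esub> y"
    using reachable_mk_symmetric_eq[OF sym_arcs] by simp
  then show ?thesis by (simp add: reachable_conv)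
qed

lemma pcas_nth:
  assumes "pcas x p y"
  shows "p \<noteq> [] \<Longrightarrow> fst (p ! 0) = x" "p \<noteq> [] \<Longrightarrow> snd (last p) = y"
    "Suc i < length p \<Longrightarrow> snd (p ! i) = fst (p ! Suc i)"
  using assms
proof (induction x p y arbitrary: i rule: pcas.induct)
  case (2 x e es y)
  { case 1 then show ?case using 2 by simp }
  { case 2 then show ?case using "2.IH"(2) by (cases es) auto }
  { case 3 then show ?case using "2.IH"(1,3) by (cases i) (auto simp: less_Suc_eq_0_disj) }
qed auto

text \<open>Turns an arc list into a cyclic listing of vertices: the sources of the arcs are the
  distinct cycle vertices, each arc leading to the source of the next one modulo the length.\<close>

lemma graph_cycle_nth:
  fixes G :: "'a pair_pre_digraph"
  assumes "graph_cycle (with_proj G) p"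
  shows "i < length p \<Longrightarrow> p ! i = (fst (p ! i), fst (p ! (Suc i mod length p)))"
    and "inj_on (\<lambda>i. fst (p ! i)) {..<length p}"
    and "set p \<subseteq> parcs G"
proof -
  obtain w where p: "set p \<subseteq> parcs G" "pcas w p w" "distinct (tl (pawalk_verts w p))" "p \<noteq> []"
    using assms by (auto simp: graph_cycle_def pre_digraph.cycle_def pre_digraph.awalk_def
        cas_with_proj_eq awalk_verts_with_proj_eq)
  show "set p \<subseteq> parcs G" by fact
  show "p ! i = (fst (p ! i), fst (p ! (Suc i mod length p)))" if "i < length p"
  proof (cases "Suc i = length p")
    case True
    then have "last p = p ! i" using p(4) by (simp add: last_conv_nth flip: True)
    then show ?thesis using True pcas_nth(1,2)[OF p(2)] p(4) by (metis mod_self prod.collapse)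
  next
    case False
    then show ?thesis using that pcas_nth(3)[OF p(2), of i] by (simp add: prod_eq_iff)
  qed
  have "pawalk_verts x q = map fst q @ [y]" if "pcas x q y" for x y and q :: "('a \<times> 'a) list"
    using that by (induction x q y rule: pcas.induct) auto
  then have "pawalk_verts w p = map fst p @ [w]" using p(2) .
  \<comment> \<open>The first source is \<open>w\<close>, so the tail of
    \<open>map fst p @ [w]\<close> is a rotation of \<open>map fst p\<close>.\<close>
  then have "distinct (map fst p)"
    using p(2-4) by (cases p) auto
  then show "inj_on (\<lambda>i. fst (p ! i)) {..<length p}"
    by (auto simp: distinct_conv_nth inj_on_def)
qed

text \<open>By symmetry, mutual reachability is one-sided reachability. An arc starting in a
  component stays in it, so only its source has to be tested.\<close>

lemma component_of_simps:
  assumes "pair_graph G" and r: "r \<in> pverts G"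
  shows verts_component_of: "verts (component_of G r) = {w. (r, w) \<in> (parcs G)\<^sup>*}"
    and dominates_component_of:
      "x \<rightarrow>\<^bsub>component_of G r\<^esub> y \<longleftrightarrow> (x, y) \<in> parcs G \<and> (r, x) \<in> (parcs G)\<^sup>*"
    and wf_digraph_component_of: "wf_digraph (component_of G r)"
    and finite_component_of: "finite (verts (component_of G r))"
    and symmetric_component_of: "symmetric (component_of G r)"
proof -
  interpret pair_graph G by fact
  have reach: "r \<rightarrow>\<^sup>*\<^bsub>with_proj G\<^esub> w \<longleftrightarrow> (r, w) \<in> (parcs G)\<^sup>*" for w
    using r reachable_conv' by simp
  have scc: "pre_digraph.scc_of (with_proj G) r = {w. (r, w) \<in> (parcs G)\<^sup>*}"
    using reach symmetric_reachable' by (auto simp: pre_digraph.scc_of_def)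
  then show verts: "verts (component_of G r) = {w. (r, w) \<in> (parcs G)\<^sup>*}"
    by (simp add: component_of_def)
  show arcs: "x \<rightarrow>\<^bsub>component_of G r\<^esub> y \<longleftrightarrow> (x, y) \<in> parcs G \<and> (r, x) \<in> (parcs G)\<^sup>*" for x y
    unfolding component_of_def scc
    by (auto simp: arcs_ends_conv image_iff intro: rtrancl_into_rtrancl)
  show "wf_digraph (component_of G r)"
    by (simp add: component_of_def wellformed_induce_subgraph)
  have "{w. (r, w) \<in> (parcs G)\<^sup>*} \<subseteq> pverts G"
    using reach reachable_in_verts(2) by blast
  then show "finite (verts (component_of G r))"
    unfolding verts by (rule finite_subset[OF _ pair_finite_verts])
  show "symmetric (component_of G r)"
    by (auto simp: symmetric_def sym_def arcs arcs_symmetric intro: rtrancl_into_rtrancl)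
qed

text \<open>Supplies the hypotheses of \<open>indep_poly_rooted_product\<close> for
  \<open>U\<close>, with \<open>cycle_graph l\<close> on the roots. Connectedness of
  \<open>T\<close> gives the covering by components, and the bridge property of tree edges their
  disjointness.\<close>

lemma unicyclic_decomposition:
  fixes T :: "'a pair_pre_digraph" and C :: "('a \<times> 'a) list" and u v :: 'a
  defines "U \<equiv> add_edge T u v" and "c \<equiv> \<lambda>i. fst (C ! i)" and "l \<equiv> length C"
  defines "D \<equiv> del_edges U (set C)"
  assumes tree: "graph_tree T"
    and uv: "u \<in> pverts T" "v \<in> pverts T" "u \<noteq> v"
    and cycle: "graph_cycle (with_proj U) C"
    and ends: "c 0 = u" "c (l - 1) = v"
  shows "pair_graph D" and "\<And>i. i < l \<Longrightarrow> c i \<in> pverts D"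
    and "pverts U = (\<Union>i<l. verts (component_of D (c i)))"
    and "\<And>i j. i < l \<Longrightarrow> j < l \<Longrightarrow> i \<noteq> j \<Longrightarrow>
      verts (component_of D (c i)) \<inter> verts (component_of D (c j)) = {}"
    and "\<And>x y. (x, y) \<in> parcs U \<longleftrightarrow> (\<exists>i<l. x \<rightarrow>\<^bsub>component_of D (c i)\<^esub> y) \<or>
      (\<exists>i j. i \<rightarrow>\<^bsub>with_proj (cycle_graph l)\<^esub> j \<and> x = c i \<and> y = c j)"
proof -
  have pgT: "pair_graph T" using tree by (simp add: graph_tree_def)
  have pgU: "pair_graph U" unfolding U_def by (rule pair_graph_add_edge[OF pgT uv])
  show pgD: "pair_graph D" unfolding D_def by (rule pair_graph_del_edges[OF pgU])
  interpret T: pair_graph T by fact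
  interpret U: pair_graph U by fact
  interpret D: pair_graph D by fact
  have l3: "3 \<le> l" using cycle by (simp add: graph_cycle_def l_def)
  have C_nth: "C ! i = (c i, c (Suc i mod l))" if "i < l" for i
    using graph_cycle_nth(1)[OF cycle] that by (simp add: c_def l_def)
  have inj: "c i = c j \<longleftrightarrow> i = j" if "i < l" "j < l" for i j
    using graph_cycle_nth(2)[OF cycle] that by (auto simp: inj_on_def c_def l_def)
  have C_U: "set C \<subseteq> parcs U" by (rule graph_cycle_nth(3)[OF cycle])
  have set_C: "set C = (\<lambda>i. (c i, c (Suc i mod l))) ` {..<l}"
    using C_nth by (auto simp: set_conv_nth l_def image_iff) metis
  have cyc_iff: "(x, y) \<in> set C \<union> (set C)\<inverse> \<longleftrightarrow>
      (\<exists>i j. i \<rightarrow>\<^bsub>with_proj (cycle_graph l)\<^esub> j \<and> x = c i \<and> y = c j)" for x y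
  proof -
    have "Suc i mod l < l" for i using l3 by simp
    then have "(x, y) \<in> set C \<longleftrightarrow>
        (\<exists>i j. i < l \<and> j < l \<and> j = (i + 1) mod l \<and> x = c i \<and> y = c j)" for x y
      unfolding set_C by (auto simp: image_iff)
    then show ?thesis unfolding dominates_cycle_graph Un_iff converse_iff by blast
  qed
  have D_simps: "pverts D = pverts U" "parcs D = parcs U - (set C \<union> (set C)\<inverse>)"
    by (simp_all add: D_def del_edges_def)
  have U_simps: "pverts U = pverts T" "parcs U = insert (u, v) (insert (v, u) (parcs T))"
    by (auto simp: U_def add_edge_def)
  \<comment> \<open>The arc closing the cycle, from \<open>c (l - 1)\<close> back to
    \<open>c 0\<close>, is the added edge. Deleting \<open>C\<close> in both orientations therefore
    leaves only arcs of \<open>T\<close>.\<close>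
  have "(v, u) = C ! (l - 1)" using C_nth[of "l - 1"] l3 ends by simp
  then have vu_C: "(v, u) \<in> set C" using l3 by (simp add: l_def)
  then have D_T: "parcs D \<subseteq> parcs T" by (auto simp: D_simps U_simps)
  show root: "c i \<in> pverts D" if "i < l" for i
    using C_nth[OF that] C_U that U.wellformed' unfolding D_simps l_def
    by (metis nth_mem subsetD)
  note comp = component_of_simps[OF pgD root]
  have sym_D: "sym ((parcs D)\<^sup>*)"
    by (rule sym_rtrancl) (use D.arcs_symmetric in \<open>auto simp: sym_def\<close>)
  \<comment> \<open>Follow a walk of \<open>T\<close> from \<open>u\<close>: each step along the
    cycle lands on some \<open>c j\<close>, which becomes the new root; every other step stays in
    \<open>D\<close>.\<close>
  have "\<exists>i<l. (c i, w) \<in> (parcs D)\<^sup>*" if "(u, w) \<in> (parcs T)\<^sup>*" for w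
    using that
  proof induction
    case base
    then show ?case using l3 ends by (intro exI[of _ 0]) auto
  next
    case (step y z)
    show ?case
    proof (cases "(y, z) \<in> set C \<union> (set C)\<inverse>")
      case True
      then obtain j where "j < l" "z = c j"
        unfolding cyc_iff dominates_cycle_graph by blast
      then show ?thesis by blast
    next
      case False
      then have "(y, z) \<in> parcs D" using step by (auto simp: D_simps U_simps)
      then show ?thesis using step.IH by (meson rtrancl_into_rtrancl)
    qed
  qed
  then have cover: "\<exists>i<l. (c i, w) \<in> (parcs D)\<^sup>*" if "w \<in> pverts T" for w
    using graph_tree_connected[OF tree uv(1) that] .
  have in_U: "w \<in> pverts U" if "i < l" "(c i, w) \<in> (parcs D)\<^sup>*" for i w
    using that(2) root[OF that(1)] unfolding D_simps(1)[symmetric]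
    by induction (auto dest: D.wellformed')
  show "pverts U = (\<Union>i<l. verts (component_of D (c i)))"
  proof (rule set_eqI)
    fix w
    have "w \<in> pverts U \<longleftrightarrow> (\<exists>i<l. (c i, w) \<in> (parcs D)\<^sup>*)"
      using cover[of w] in_U[of _ w] U_simps(1) by blast
    then show "w \<in> pverts U \<longleftrightarrow> w \<in> (\<Union>i<l. verts (component_of D (c i)))"
      using comp(1) by (simp add: Bex_def)
  qed
  \<comment> \<open>Otherwise the cycle from \<open>c (Suc i)\<close> to \<open>c j\<close>,
    followed by the return to \<open>c i\<close> inside \<open>D\<close>, bypasses the tree edge
    from \<open>c i\<close> to \<open>c (Suc i)\<close>.\<close>
  have sep: "(c i, c j) \<notin> (parcs D)\<^sup>*" if ij: "i < j" "j < l" for i j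
  proof
    assume "(c i, c j) \<in> (parcs D)\<^sup>*"
    let ?e = "{(c i, c (Suc i)), (c (Suc i), c i)}"
    let ?T = "parcs T - ?e"
    have arc_C: "(c k, c (Suc k)) \<in> set C" if "k < j" for k
      using C_nth[of k] that ij nth_mem[of k C] by (simp add: l_def)
    have arc_T: "(c k, c (Suc k)) \<in> parcs T" if "k < j" for k
    proof -
      have k: "k < l" "Suc k < l" "k \<noteq> l - 1" using that ij by auto
      \<comment> \<open>These inequalities exclude both orientations of the added edge. Excluding
        \<open>(u, v)\<close> uses \<open>3 \<le> l\<close>, since for \<open>l = 2\<close> the arc
        from \<open>c 0\<close> would end in \<open>c (l - 1)\<close>.\<close>
      then have "c k \<noteq> c (l - 1)" "c (Suc k) \<noteq> c 0" "\<not> (c k = c 0 \<and> c (Suc k) = c (l - 1))"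
        using inj[of k "l - 1"] inj[of "Suc k" 0] inj[of k 0] inj[of "Suc k" "l - 1"] l3 by linarith+
      then show ?thesis using arc_C[OF that] C_U unfolding ends U_simps by blast
    qed
    have "(c (Suc i), c (Suc i + d)) \<in> ?T\<^sup>*" if "Suc i + d \<le> j" for d
      using that
    proof (induction d)
      case (Suc d)
      \<comment> \<open>All indices here lie strictly between \<open>i\<close> and \<open>l\<close>,
        so neither end is \<open>c i\<close> and the arc is not the removed one.\<close>
      have "(c (Suc i + d), c (Suc (Suc i + d))) \<in> ?T"
        using arc_T[of "Suc i + d"] Suc.prems ij
          inj[of "Suc i + d" i] inj[of "Suc (Suc i + d)" i] by auto
      then show ?case using Suc by (auto intro: rtrancl_into_rtrancl)
    qed auto
    from this[of "j - Suc i"] have "(c (Suc i), c j) \<in> ?T\<^sup>*" using ij by simp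
    moreover have "parcs D \<subseteq> ?T" using D_T arc_C[OF ij(1)] by (auto simp: D_simps)
    then have "(c j, c i) \<in> ?T\<^sup>*"
      using \<open>(c i, c j) \<in> (parcs D)\<^sup>*\<close> sym_D rtrancl_mono by (blast dest: symD)
    ultimately have "(c (Suc i), c i) \<in> ?T\<^sup>*" by (rule rtrancl_trans)
    with graph_tree_bridge[OF tree arc_T[OF ij(1)]] show False by simp
  qed
  show "verts (component_of D (c i)) \<inter> verts (component_of D (c j)) = {}"
    if "i < l" "j < l" "i \<noteq> j" for i j
  proof -
    have "(c i, c j) \<notin> (parcs D)\<^sup>*"
      using that sep[of i j] sep[of j i] sym_D by (metis linorder_neqE_nat symD)
    then show ?thesis
      using comp(1) that sym_D by (auto dest: symD rtrancl_trans)
  qed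
  show "(x, y) \<in> parcs U \<longleftrightarrow> (\<exists>i<l. x \<rightarrow>\<^bsub>component_of D (c i)\<^esub> y) \<or>
      (\<exists>i j. i \<rightarrow>\<^bsub>with_proj (cycle_graph l)\<^esub> j \<and> x = c i \<and> y = c j)" for x y
  proof -
    have "(x, y) \<in> parcs D \<longleftrightarrow> (\<exists>i<l. x \<rightarrow>\<^bsub>component_of D (c i)\<^esub> y)"
    proof -
      have "x \<in> pverts T" if "(x, y) \<in> parcs D"
        using D.in_arcsD1[OF that] by (simp add: D_simps(1) U_simps(1))
      then show ?thesis using cover[of x] by (simp add: comp(2) cong: conj_cong) blast
    qed
    moreover have "(x, y) \<in> parcs U \<longleftrightarrow> (x, y) \<in> parcs D \<or> (x, y) \<in> set C \<union> (set C)\<inverse>"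
      using C_U U.arcs_symmetric by (auto simp: D_simps)
    ultimately show ?thesis using cyc_iff by simp
  qed
qed

section \<open>The transfer formula for \<open>U\<close> and its constant case\<close>

theorem proposition2p7:
  fixes T U :: "'a pair_pre_digraph"
    and u v :: 'a
    and C :: "('a \<times> 'a) list"
    and \<l> :: nat
    and c :: "nat \<Rightarrow> 'a"
    and R :: "nat \<Rightarrow> ('a, 'a \<times> 'a) pre_digraph"
    and A B :: "nat \<Rightarrow> int poly"
    and f g :: "nat \<Rightarrow> nat \<Rightarrow> int poly"
  assumes tree: "graph_tree T"
    and uv: "u \<in> pverts T" "v \<in> pverts T" "u \<noteq> v" "(u, v) \<notin> parcs T"
    and U: "U = add_edge T u v"
    and cycle: "graph_cycle (with_proj U) C"
    and len: "\<l> = length C"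
    and c: "\<And>i. i < \<l> \<Longrightarrow> c i = fst (C ! i)"
    and ends: "c 0 = u" "c (\<l> - 1) = v"
    and R: "\<And>i. i < \<l> \<Longrightarrow> R i = component_of (del_edges U (set C)) (c i)"
    and A: "\<And>i. i < \<l> \<Longrightarrow> A i = indep_poly (del_verts (R i) {c i})"
    and B: "\<And>i. i < \<l> \<Longrightarrow> B i = [:0, 1:] * indep_poly (del_verts (R i) (closed_nbhd (R i) (c i)))"
    and init: "f 0 0 = A 0" "g 0 0 = 0" "f 1 0 = 0" "g 1 0 = B 0"
    and step_f: "\<And>i \<epsilon>. 1 \<le> i \<Longrightarrow> i \<le> \<l> - 1 \<Longrightarrow> \<epsilon> \<in> {0, 1} \<Longrightarrow>
                   f \<epsilon> i = (f \<epsilon> (i - 1) + g \<epsilon> (i - 1)) * A i"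
    and step_g: "\<And>i \<epsilon>. 1 \<le> i \<Longrightarrow> i \<le> \<l> - 1 \<Longrightarrow> \<epsilon> \<in> {0, 1} \<Longrightarrow>
                   g \<epsilon> i = f \<epsilon> (i - 1) * B i"
  shows "indep_poly (with_proj U) = (f 0 (\<l> - 1) + g 0 (\<l> - 1)) + f 1 (\<l> - 1) \<and>
    (\<forall>A' B'. (\<forall>i<\<l>. A i = A' \<and> B i = B') \<longrightarrow>
       to_fract (indep_poly (with_proj U)) =
         to_fract A' ^ \<l> *
         poly (map_poly of_int (indep_poly (with_proj (cycle_graph \<l>))))
           (to_fract B' / to_fract A'))"
proof -
  let ?D = "del_edges U (set C)" and ?H = "with_proj (cycle_graph \<l>)"
  let ?G = "\<lambda>i. component_of ?D (fst (C ! i))"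
  let ?w = "\<lambda>J. \<Prod>i<\<l>. if i \<in> J then B i else A i"
  have l3: "3 \<le> \<l>" using cycle by (simp add: graph_cycle_def len)
  define n where "n = \<l> - 1"
  have l_Suc: "\<l> = Suc n" using l3 by (simp add: n_def)
  \<comment> \<open>The function \<open>c\<close> is prescribed only below \<open>\<l>\<close>, so
    the argument works with \<open>fst (C ! i)\<close> throughout.\<close>
  have "fst (C ! 0) = u" "fst (C ! (length C - 1)) = v"
    using ends c[of 0] c[of "\<l> - 1"] l3 unfolding len by force+
  note dec = unicyclic_decomposition[OF tree uv(1-3) cycle[unfolded U] this, folded U len]
  note comp = component_of_simps[OF dec(1,2)]
  have R_eq: "R i = ?G i" if "i < \<l>" for i using R c that by simp
  interpret D: pair_graph ?D by (rule dec(1))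
  have no_loop: "\<not> x \<rightarrow>\<^bsub>?G i\<^esub> x" if "i < \<l>" for i x
    using comp(2)[OF that] D.no_loops' by blast
  have root_in: "fst (C ! i) \<in> verts (?G i)" if "i < \<l>" for i
    using comp(1)[OF that] by simp
  have A_sum: "A i = (\<Sum>S | indep_set (?G i) S \<and> fst (C ! i) \<notin> S. monom 1 (card S))"
    and B_sum: "B i = (\<Sum>S | indep_set (?G i) S \<and> fst (C ! i) \<in> S. monom 1 (card S))"
    if "i < \<l>" for i
    using A[OF that] B[OF that] R_eq[OF that] c[OF that]
      indep_poly_del_vert[OF comp(4)[OF that]]
      indep_poly_del_closed_nbhd[OF comp(4)[OF that] root_in[OF that] comp(5)[OF that]
        no_loop[OF that]]
    by simp_all
  have "wf_digraph ?H"
    by unfold_locales (auto simp: cycle_graph_def)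
  have "indep_poly (with_proj U) = (\<Sum>J | indep_set ?H J. \<Prod>i\<in>verts ?H.
      \<Sum>S | indep_set (?G i) S \<and> (fst (C ! i) \<in> S \<longleftrightarrow> i \<in> J). monom 1 (card S))"
    by (rule indep_poly_rooted_product)
      (use dec(3-5) comp(1,3,4) \<open>wf_digraph ?H\<close> in \<open>simp_all add: pverts_cycle_graph Bex_def\<close>)
  also have "\<dots> = (\<Sum>J | indep_set ?H J. ?w J)"
    by (intro sum.cong prod.cong refl) (auto simp: pverts_cycle_graph A_sum B_sum)
  finally have I_U: "indep_poly (with_proj U) = (\<Sum>J | indep_set ?H J. ?w J)" .
  \<comment> \<open>The initial values for \<epsilon> = 0 are those of \<open>b = False\<close>, and
    those for \<epsilon> = 1 below are those of \<open>b = True\<close>.\<close>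
  have "f 0 (\<l> - 1) = (\<Sum>J | J \<in> path_indep_sets n \<and> n \<notin> J \<and> (0 \<in> J \<longleftrightarrow> False). ?w J)"
    "g 0 (\<l> - 1) = (\<Sum>J | J \<in> path_indep_sets n \<and> n \<in> J \<and> (0 \<in> J \<longleftrightarrow> False). ?w J)"
    using sum_path_indep_sets_transfer[of "f 0" False A "g 0" B n] init
      step_f[of _ 0] step_g[of _ 0]
    unfolding l_Suc lessThan_Suc_atMost by simp_all
  moreover have
    "f 1 (\<l> - 1) = (\<Sum>J | J \<in> path_indep_sets n \<and> n \<notin> J \<and> (0 \<in> J \<longleftrightarrow> True). ?w J)"
    using sum_path_indep_sets_transfer(1)[of "f 1" True A "g 1" B n] init
      step_f[of _ 1] step_g[of _ 1]
    unfolding l_Suc lessThan_Suc_atMost by simp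
  ultimately have "indep_poly (with_proj U) = (f 0 (\<l> - 1) + g 0 (\<l> - 1)) + f 1 (\<l> - 1)"
    using sum_indep_sets_cycle_graph[of ?w n, folded l_Suc] I_U by simp
  moreover have "to_fract (indep_poly (with_proj U)) =
      to_fract A' ^ \<l> * poly (map_poly of_int (indep_poly ?H)) (to_fract B' / to_fract A')"
    if const: "\<forall>i<\<l>. A i = A' \<and> B i = B'" for A' B'
  proof -
    have "A' = indep_poly (del_verts (R 0) {c 0})"
      using const A[of 0] l3 by auto
    \<comment> \<open>Division by zero gives zero in the fraction field, so factoring
      \<open>A'\<close> out of each factor needs this.\<close>
    then have "A' \<noteq> 0"
      using l3 comp(4)[of 0] R_eq[of 0] by (simp add: indep_poly_nonzero verts_del_verts)
    have "to_fract (?w J) = to_fract A' ^ \<l> * (to_fract B' / to_fract A') ^ card J"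
      if "indep_set ?H J" for J
    proof -
      \<comment> \<open>The induction runs over subsets of \<open>{..<\<l>}\<close> because
        \<open>A\<close> and \<open>B\<close> are known to be constant only there.\<close>
      have "to_fract (\<Prod>i\<in>I. if i \<in> J then B i else A i) =
          (\<Prod>i\<in>I. if i \<in> J then to_fract B' else to_fract A')" if "I \<subseteq> {..<\<l>}" for I
        using finite_subset[OF that finite_lessThan] that
        by induction (use const in auto)
      then show ?thesis
        using prod_if_mem_eq_power[of "{..<\<l>}" J "to_fract A'" "to_fract B'"] \<open>A' \<noteq> 0\<close> that
        by (simp add: indep_set_def pverts_cycle_graph)
    qed
    then show ?thesis
      by (simp add: I_U poly_of_int_indep_poly pverts_cycle_graph sum_distrib_left)
  qed
  ultimately show ?thesis by blast
qed

end
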